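(* For any groups $G_1,\ldots,G_s$, the inequality $$J_{G_1\times\cdots\times G_s}\ge J_{G_1}\cdots J_{G_s}$$ holds (if $J_{G_i}=\infty$ for some $i$, then by definition the inequality means that $J_{G_1\times\cdots\times G_s}=\infty$).
   Context: For a finite group $H$, put $m_H:=\min_S[H:S]$, where $S$ runs over all normal Abelian subgroups of $H$. For any group $G$, put $J_G:=\sup_F m_F$, where $F$ runs over all finite subgroups of $G$ (so $J_G$ is a positive integer or $\infty$). *)

theory Defs
  imports "HOL-Algebra.Algebra" "HOL-Library.Extended_Nat"
begin

text \<open>
  For finite \<open>H\<close> the set below is finite and contains the index of the trivial subgroup, so
  \<open>Min\<close> is a genuine minimum. For infinite \<open>H\<close> the value is not meaningful.
\<close>

definition min_normal_abelian_index :: "('a, 'b) monoid_scheme \<Rightarrow> nat" where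
  "min_normal_abelian_index H =
     Min {card (rcosets\<^bsub>H\<^esub> S) | S. S \<lhd> H \<and> comm_group (H\<lparr>carrier := S\<rparr>)}"

definition jordan_const :: "('a, 'b) monoid_scheme \<Rightarrow> enat" where
  "jordan_const G =
     (SUP F \<in> {F. subgroup F G \<and> finite F}. enat (min_normal_abelian_index (G\<lparr>carrier := F\<rparr>)))"

text \<open>
  In \<^typ>\<open>enat\<close> we have \<open>0 * \<infinity> = 0\<close>. The following two lemmas rule out a zero factor, so a product of
  Jordan constants over a finite index set is \<open>\<infinity>\<close> as soon as one factor is.
\<close>

lemma min_normal_abelian_index_pos:
  assumes "group H" "finite (carrier H)"
  shows "min_normal_abelian_index H > 0"
proof -
  interpret group H by fact
  let ?A = "{card (rcosets\<^bsub>H\<^esub> S) | S. S \<lhd> H \<and> comm_group (H\<lparr>carrier := S\<rparr>)}"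
  have fin: "finite (rcosets\<^bsub>H\<^esub> S)" for S
  proof -
    have "rcosets\<^bsub>H\<^esub> S = (\<lambda>a. S #>\<^bsub>H\<^esub> a) ` carrier H"
      by (auto simp: RCOSETS_def)
    then show ?thesis using assms(2) by simp
  qed
  have "?A \<subseteq> (\<lambda>S. card (rcosets\<^bsub>H\<^esub> S)) ` Pow (carrier H)"
    using normal_imp_subgroup subgroup.subset by blast
  then have "finite ?A"
    using assms(2) finite_subset by blast
  moreover have "comm_group (H\<lparr>carrier := {\<one>\<^bsub>H\<^esub>}\<rparr>)"
    by unfold_locales (auto simp: Units_def)
  then have "?A \<noteq> {}"
    using one_is_normal by blast
  ultimately have "Min ?A \<in> ?A" by (rule Min_in)
  then obtain S where S: "S \<lhd> H" "Min ?A = card (rcosets\<^bsub>H\<^esub> S)" by blast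
  have "rcosets\<^bsub>H\<^esub> S \<noteq> {}" by (auto simp: RCOSETS_def)
  then show ?thesis
    using S fin[of S] unfolding min_normal_abelian_index_def by (simp add: card_gt_0_iff)
qed

lemma one_le_jordan_const:
  assumes "group G"
  shows "jordan_const G \<ge> 1"
proof -
  interpret group G by fact
  have sub: "subgroup {\<one>\<^bsub>G\<^esub>} G" by (rule triv_subgroup)
  have "group (G\<lparr>carrier := {\<one>\<^bsub>G\<^esub>}\<rparr>)"
    using sub subgroup_imp_group by blast
  then have "1 \<le> enat (min_normal_abelian_index (G\<lparr>carrier := {\<one>\<^bsub>G\<^esub>}\<rparr>))"
    using min_normal_abelian_index_pos[of "G\<lparr>carrier := {\<one>\<^bsub>G\<^esub>}\<rparr>"] by (simp add: one_enat_def Suc_le_eq)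
  also have "\<dots> \<le> jordan_const G"
    unfolding jordan_const_def using sub by (intro SUP_upper) auto
  finally show ?thesis .
qed

end

theory Submission
  imports Defs
begin

text \<open>
  If \<open>S\<close> is a normal abelian subgroup of a finite product \<open>\<Prod>\<^sub>i H\<^sub>i\<close>, then each projection \<open>S\<^sub>i\<close> is
  normal abelian in \<open>H\<^sub>i\<close> and \<open>S \<subseteq> \<Prod>\<^sub>i S\<^sub>i\<close>, so the index of \<open>S\<close> is at least the product of the
  indices of the \<open>S\<^sub>i\<close>. Apply this to products of finite subgroups. If the Jordan constant of the
  product is finite, then so is that of each factor, and each of these suprema is attained.
\<close>

lemma finite_normal_abelian_indices:
  assumes "finite (carrier H)"
  shows "finite {card (rcosets\<^bsub>H\<^esub> S) | S. S \<lhd> H \<and> comm_group (H\<lparr>carrier := S\<rparr>)}"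
proof (rule finite_subset)
  show "{card (rcosets\<^bsub>H\<^esub> S) | S. S \<lhd> H \<and> comm_group (H\<lparr>carrier := S\<rparr>)}
      \<subseteq> (\<lambda>S. card (rcosets\<^bsub>H\<^esub> S)) ` Pow (carrier H)"
    using normal_imp_subgroup subgroup.subset by blast
qed (simp add: assms)

lemma min_normal_abelian_index_le:
  assumes "finite (carrier H)" "S \<lhd> H" "comm_group (H\<lparr>carrier := S\<rparr>)"
  shows "min_normal_abelian_index H \<le> card (rcosets\<^bsub>H\<^esub> S)"
  unfolding min_normal_abelian_index_def
  using assms by (intro Min_le finite_normal_abelian_indices) auto

lemma min_normal_abelian_index_attained:
  assumes "group H" "finite (carrier H)"
  obtains S where "S \<lhd> H" "comm_group (H\<lparr>carrier := S\<rparr>)"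
    "min_normal_abelian_index H = card (rcosets\<^bsub>H\<^esub> S)"
proof -
  interpret group H by fact
  let ?A = "{card (rcosets\<^bsub>H\<^esub> S) | S. S \<lhd> H \<and> comm_group (H\<lparr>carrier := S\<rparr>)}"
  have "comm_group (H\<lparr>carrier := {\<one>\<^bsub>H\<^esub>}\<rparr>)"
    by unfold_locales (auto simp: Units_def)
  then have "?A \<noteq> {}"
    using one_is_normal by blast
  then have "Min ?A \<in> ?A"
    using assms(2) by (intro Min_in finite_normal_abelian_indices)
  then show thesis
    using that unfolding min_normal_abelian_index_def by blast
qed

lemma comm_group_hom_image:
  assumes "group_hom G H h" "subgroup S G" "comm_group (G\<lparr>carrier := S\<rparr>)"
  shows "comm_group (H\<lparr>carrier := h ` S\<rparr>)"
proof -
  interpret group_hom G H h by fact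
  have "h \<in> hom (G\<lparr>carrier := S\<rparr>) H"
    using subgroup.mem_carrier[OF assms(2)] by (auto simp: hom_def)
  from comm_group.hom_imp_img_comm_group[OF assms(3) this] show ?thesis
    by simp
qed

lemma group_hom_product_group_proj:
  assumes "\<And>i. i \<in> I \<Longrightarrow> group (G i)" "j \<in> I"
  shows "group_hom (product_group I G) (G j) (\<lambda>x. x j)"
  using assms by (auto simp: group_hom_def group_hom_axioms_def hom_def)

text \<open>A homomorphism carries normal subgroups to normal subgroups only when it is onto. A
  projection is onto because every factor contains its unit, so the product is nonempty.\<close>

lemma product_group_proj_surj:
  assumes "\<And>i. i \<in> I \<Longrightarrow> group (G i)" "j \<in> I"
  shows "(\<lambda>x. x j) ` carrier (product_group I G) = carrier (G j)"
proof -
  have "(\<Pi>\<^sub>E i\<in>I. carrier (G i)) \<noteq> {}"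
    using assms(1) group.is_monoid monoid.one_closed by (fastforce simp: PiE_eq_empty_iff)
  then show ?thesis
    using assms(2) by (simp add: image_projection_PiE)
qed

lemma prod_min_normal_abelian_index_le:
  assumes I: "finite I"
    and grp: "\<And>i. i \<in> I \<Longrightarrow> group (G i)" and fin: "\<And>i. i \<in> I \<Longrightarrow> finite (carrier (G i))"
  shows "(\<Prod>i\<in>I. min_normal_abelian_index (G i)) \<le> min_normal_abelian_index (product_group I G)"
proof -
  let ?P = "product_group I G"
  have P: "group ?P" "finite (carrier ?P)"
    using grp I fin by (auto intro: finite_PiE)
  obtain S where S: "S \<lhd> ?P" "comm_group (?P\<lparr>carrier := S\<rparr>)"
    and m: "min_normal_abelian_index ?P = card (rcosets\<^bsub>?P\<^esub> S)"
    using min_normal_abelian_index_attained[OF P] .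
  have subS: "subgroup S ?P"
    using S(1) by (rule normal_imp_subgroup)
  define T where "T i = (\<lambda>x. x i) ` S" for i
  have T: "T i \<lhd> G i" "comm_group (G i\<lparr>carrier := T i\<rparr>)" if "i \<in> I" for i
    unfolding T_def
    using normal.surj_hom_normal_subgroup[OF S(1)] comm_group_hom_image[OF _ subS S(2)]
      group_hom_product_group_proj[of I G] product_group_proj_surj[of I G] grp that by blast+
  have finT: "finite (T i)" if "i \<in> I" for i
    using fin T(1) that normal_imp_subgroup subgroup.subset finite_subset by metis
  \<comment> \<open>Elements of \<open>S\<close> lie in the carrier of the product, so they already
    take the default value \<open>undefined\<close> off \<open>I\<close>; only the coordinates in
    \<open>I\<close> matter here.\<close>
  have "S \<subseteq> PiE I T"
    using subgroup.subset[OF subS] by (fastforce simp: T_def PiE_iff)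
  then have "card S \<le> card (PiE I T)"
    using I finT by (intro card_mono finite_PiE)
  then have cardS: "card S \<le> (\<Prod>i\<in>I. card (T i))"
    using I by (simp add: card_PiE)
  \<comment> \<open>Lagrange in each factor and in the product writes the order of the product group
    in two ways, which turns the upper bound on \<open>card S\<close> into a lower bound on its
    index.\<close>
  have "(\<Prod>i\<in>I. card (rcosets\<^bsub>G i\<^esub> T i)) * (\<Prod>i\<in>I. card (T i)) = (\<Prod>i\<in>I. order (G i))"
    using group.lagrange[OF grp normal_imp_subgroup[OF T(1)]]
    by (simp flip: prod.distrib)
  also have "\<dots> = card (rcosets\<^bsub>?P\<^esub> S) * card S"
    using group.lagrange[OF P(1) subS] I by (simp add: order_def card_PiE)
  also have "\<dots> \<le> card (rcosets\<^bsub>?P\<^esub> S) * (\<Prod>i\<in>I. card (T i))"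
    using cardS by simp
  finally have "(\<Prod>i\<in>I. card (rcosets\<^bsub>G i\<^esub> T i)) * (\<Prod>i\<in>I. card (T i))
      \<le> card (rcosets\<^bsub>?P\<^esub> S) * (\<Prod>i\<in>I. card (T i))" .
  \<comment> \<open>Each \<open>T i\<close> is finite and contains the unit, so the common factor
    can be cancelled.\<close>
  moreover have "(\<Prod>i\<in>I. card (T i)) > 0"
    using T(1) normal_imp_subgroup subgroup.one_closed finT
    by (intro prod_pos) (fastforce simp: card_gt_0_iff)
  ultimately have "(\<Prod>i\<in>I. card (rcosets\<^bsub>G i\<^esub> T i)) \<le> card (rcosets\<^bsub>?P\<^esub> S)"
    by simp
  moreover have "(\<Prod>i\<in>I. min_normal_abelian_index (G i)) \<le> (\<Prod>i\<in>I. card (rcosets\<^bsub>G i\<^esub> T i))"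
    using T fin by (intro prod_mono) (auto intro: min_normal_abelian_index_le)
  ultimately show ?thesis
    using m by simp
qed

text \<open>The box \<open>PiE I F\<close> is a finite subgroup of the product, so it is one of the
  groups over which the supremum is taken.\<close>

lemma prod_le_jordan_const_product_group:
  assumes I: "finite I" and grp: "\<And>i. i \<in> I \<Longrightarrow> group (G i)"
    and F: "\<And>i. i \<in> I \<Longrightarrow> subgroup (F i) (G i)" "\<And>i. i \<in> I \<Longrightarrow> finite (F i)"
  shows "enat (\<Prod>i\<in>I. min_normal_abelian_index (G i\<lparr>carrier := F i\<rparr>))
    \<le> jordan_const (product_group I G)"
proof -
  \<comment> \<open>Multiplication and unit of a product group do not depend on the carriers of its
    factors.\<close>
  have eq: "product_group I G\<lparr>carrier := PiE I F\<rparr> = product_group I (\<lambda>i. G i\<lparr>carrier := F i\<rparr>)"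
    by (simp add: product_group_def)
  have "enat (\<Prod>i\<in>I. min_normal_abelian_index (G i\<lparr>carrier := F i\<rparr>))
      \<le> enat (min_normal_abelian_index (product_group I G\<lparr>carrier := PiE I F\<rparr>))"
    unfolding eq enat_ord_simps using I F group.subgroup_imp_group[OF grp]
    by (intro prod_min_normal_abelian_index_le) auto
  also have "\<dots> \<le> jordan_const (product_group I G)"
    unfolding jordan_const_def using assms
    by (intro SUP_upper) (auto simp: PiE_subgroup_product_group intro: finite_PiE)
  finally show ?thesis .
qed

lemma jordan_const_factor_le:
  assumes I: "finite I" and grp: "\<And>i. i \<in> I \<Longrightarrow> group (G i)" and j: "j \<in> I"
  shows "jordan_const (G j) \<le> jordan_const (product_group I G)"
  unfolding jordan_const_def[of "G j"]
proof (intro SUP_least, clarify)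
  fix H assume H: "subgroup H (G j)" "finite H"
  \<comment> \<open>The box with \<open>H\<close> in coordinate \<open>j\<close> and trivial groups
    elsewhere; the remaining factors of the product of indices only have to be positive.\<close>
  define F where "F i = (if i = j then H else {\<one>\<^bsub>G i\<^esub>})" for i
  have F: "subgroup (F i) (G i)" "finite (F i)" if "i \<in> I" for i
    using H grp that by (auto simp: F_def group.triv_subgroup)
  let ?m = "\<lambda>i. min_normal_abelian_index (G i\<lparr>carrier := F i\<rparr>)"
  have "?m i > 0" if "i \<in> I" for i
    using F that group.subgroup_imp_group[OF grp] by (intro min_normal_abelian_index_pos) auto
  then have "?m j dvd (\<Prod>i\<in>I. ?m i)" "(\<Prod>i\<in>I. ?m i) > 0"
    using I j by (auto intro: prod_pos)
  then have "enat (?m j) \<le> enat (\<Prod>i\<in>I. ?m i)"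
    by (auto intro: dvd_imp_le)
  also have "\<dots> \<le> jordan_const (product_group I G)"
    using I grp F by (rule prod_le_jordan_const_product_group)
  finally show "enat (min_normal_abelian_index (G j\<lparr>carrier := H\<rparr>)) \<le> jordan_const (product_group I G)"
    by (simp add: F_def)
qed

text \<open>In \<open>enat\<close> an infinite set has supremum \<open>\<infinity>\<close>. A
  supremum other than \<open>\<infinity>\<close> thus comes from a finite set of values, nonempty
  because of the trivial subgroup, and is its maximum.\<close>

lemma jordan_const_attained:
  assumes "group G" "jordan_const G \<noteq> \<infinity>"
  obtains F where "subgroup F G" "finite F"
    "jordan_const G = enat (min_normal_abelian_index (G\<lparr>carrier := F\<rparr>))"
proof -
  let ?A = "(\<lambda>F. enat (min_normal_abelian_index (G\<lparr>carrier := F\<rparr>))) ` {F. subgroup F G \<and> finite F}"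
  have "?A \<noteq> {}"
    using group.triv_subgroup[OF assms(1)] by blast
  then have "Sup ?A \<in> ?A"
    using assms(2) Max_in[of ?A] unfolding jordan_const_def Sup_enat_def by (auto split: if_splits)
  then show thesis
    using that unfolding jordan_const_def by blast
qed

lemma prod_enat: "(\<Prod>i\<in>I. enat (f i)) = enat (\<Prod>i\<in>I. f i)"
  by (induction I rule: infinite_finite_induct) (simp_all add: one_enat_def)

theorem lemma3p2:
  fixes G :: "nat \<Rightarrow> ('a, 'b) monoid_scheme" and s :: nat
  assumes "\<And>i. i \<in> {1..s} \<Longrightarrow> group (G i)"
  shows "jordan_const (product_group {1..s} G) \<ge> (\<Prod>i\<in>{1..s}. jordan_const (G i))"
proof (cases "jordan_const (product_group {1..s} G) = \<infinity>")
  case False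
  have "\<exists>F. subgroup F (G i) \<and> finite F
      \<and> jordan_const (G i) = enat (min_normal_abelian_index (G i\<lparr>carrier := F\<rparr>))"
    if i: "i \<in> {1..s}" for i
  proof -
    have "jordan_const (G i) \<noteq> \<infinity>"
      using jordan_const_factor_le[of "{1..s}" G i] assms i False
      by (metis finite_atLeastAtMost enat_ord_simps(5))
    then show ?thesis
      using jordan_const_attained[OF assms[OF i]] by metis
  qed
  then obtain F where F: "\<And>i. i \<in> {1..s} \<Longrightarrow> subgroup (F i) (G i)"
      "\<And>i. i \<in> {1..s} \<Longrightarrow> finite (F i)"
    and J: "\<And>i. i \<in> {1..s} \<Longrightarrow>
      jordan_const (G i) = enat (min_normal_abelian_index (G i\<lparr>carrier := F i\<rparr>))"
    by metis
  \<comment> \<open>With a maximizing subgroup chosen in every factor, the product in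
    \<open>enat\<close> becomes a product of natural numbers.\<close>
  have "(\<Prod>i\<in>{1..s}. jordan_const (G i))
      = enat (\<Prod>i\<in>{1..s}. min_normal_abelian_index (G i\<lparr>carrier := F i\<rparr>))"
    using J by (simp add: prod_enat)
  also have "\<dots> \<le> jordan_const (product_group {1..s} G)"
    using assms F by (intro prod_le_jordan_const_product_group) auto
  finally show ?thesis .
qed simp

end
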